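(* Let $\Gamma$ be a loopless directed graph on vertices $v_1,\dots,v_n$ with at least one arc, let $\overline{L}$ be its normalized Laplacian with eigenvalues $\lambda_1,\dots,\lambda_n$, and let $M=(I-\overline{L})^{t}$. Then the von Neumann entropy $S(\vec\lambda)=\sum_{k=1}^n f(\lambda_k)$ satisfies $$S(\vec\lambda)=\frac{1}{\log 2}\left(\mathrm{tr}(M)-\sum_{j=2}^\infty\frac{\mathrm{tr}(M^j)}{j(j-1)}\right)=\frac{1}{\log 2}\left(n-1-\sum_{k=1}^n\sum_{j=2}^\infty\frac{P(w_j(v_k)\text{ ends at }v_k)}{j(j-1)}\right).$$
   Context: Directed graphs are finite, without loops or multiple arcs; both $x\to y$ and $y\to x$ may be present (so undirected graphs are included as symmetric directed graphs). $d^+(v_i)$ is the out-degree of $v_i$ and $g=\sum_{i=1}^n d^+(v_i)$. The Laplacian $L$ has $L(i,i)=d^+(v_i)$, $L(i,j)=-1$ if $v_i\to v_j$ is an arc and $L(i,j)=0$ otherwise for $i\ne j$; the normalized Laplacian is $\overline{L}=\frac{1}{\mathrm{tr}(L)}L=\frac1g L$. Eigenvalues $\lambda_1,\dots,\lambda_n\in\mathbb{C}$ are listed with algebraic multiplicity. $f(\lambda)=\lambda\log_2\frac1\lambda$ for $\lambda\neq0$ and $f(0)=0$, where for complex $\lambda$ the logarithm is the principal branch (so $f(\lambda)=-\lambda\,\mathrm{Log}(\lambda)/\log 2$); $\log$ is the natural logarithm. The random walk $w_j(v_k)$ has length $j$ (that is, $j$ steps) and starts at $v_k$; at each step, from the current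 vertex $v$, it moves to each vertex of the out-set of $v$ with probability $1/g$ and stays at $v$ with the remaining probability $1-d^+(v)/g$. *)

theory Defs
  imports
    "HOL-Probability.Probability_Mass_Function"
    "HOL-Analysis.Complex_Transcendental"
    "Graph_Theory.Digraph"
    "Jordan_Normal_Form.Char_Poly"
begin

section \<open>Trace and eigenvalues\<close>

definition mat_trace :: "'a::comm_monoid_add mat \<Rightarrow> 'a" where
  "mat_trace A = (\<Sum>i<dim_row A. A $$ (i, i))"

text \<open>The list \<open>es\<close> enumerates the complex eigenvalues of a real matrix with algebraic
  multiplicity; \<^const>\<open>proots\<close> is the multiset of roots counted with multiplicity.\<close>

definition lists_eigenvalues :: "real mat \<Rightarrow> complex list \<Rightarrow> bool" where
  "lists_eigenvalues A es \<longleftrightarrow> mset es = proots (char_poly (map_mat complex_of_real A))"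


section \<open>Laplacians of a directed graph\<close>

definition total_out_degree :: "('a, 'b) pre_digraph \<Rightarrow> nat" where
  "total_out_degree G = (\<Sum>v\<in>verts G. out_degree G v)"

text \<open>The list \<open>vs\<close> fixes the enumeration of the vertices; matrix indices start at \<open>0\<close>.\<close>

definition laplacian :: "('a, 'b) pre_digraph \<Rightarrow> 'a list \<Rightarrow> real mat" where
  "laplacian G vs = Matrix.mat (length vs) (length vs) (\<lambda>(i, j).
     if i = j then real (out_degree G (vs ! i))
     else if dominates G (vs ! i) (vs ! j) then - 1
     else 0)"

definition normalized_laplacian :: "('a, 'b) pre_digraph \<Rightarrow> 'a list \<Rightarrow> real mat" where
  "normalized_laplacian G vs = (1 / mat_trace (laplacian G vs)) \<cdot>\<^sub>m laplacian G vs"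


section \<open>Von Neumann entropy\<close>

definition entropy_fun :: "complex \<Rightarrow> complex" where
  "entropy_fun z = (if z = 0 then 0 else - z * Ln z / complex_of_real (ln 2))"

text \<open>The form \<open>z * log\<^sub>2 (1 / z)\<close> agrees with this one off the branch cut.\<close>

lemma entropy_fun_eq_log_inverse:
  assumes "z \<notin> \<real>\<^sub>\<le>\<^sub>0"
  shows "entropy_fun z = z * (Ln (1 / z) / complex_of_real (ln 2))"
proof -
  have "Ln (1 / z) = - Ln z"
    using Ln_inverse[OF assms] by (simp add: divide_inverse)
  moreover have "z \<noteq> 0"
    using assms by auto
  ultimately show ?thesis
    by (simp add: entropy_fun_def)
qed

definition von_neumann_entropy :: "complex list \<Rightarrow> complex" where
  "von_neumann_entropy es = (\<Sum>k<length es. entropy_fun (es ! k))"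


section \<open>The random walk\<close>

definition step_prob :: "('a, 'b) pre_digraph \<Rightarrow> 'a \<Rightarrow> 'a \<Rightarrow> real" where
  "step_prob G v u =
     (if u = v then 1 - real (out_degree G v) / real (total_out_degree G)
      else if dominates G v u then 1 / real (total_out_degree G)
      else 0)"

definition step_pmf :: "('a, 'b) pre_digraph \<Rightarrow> 'a \<Rightarrow> 'a pmf" where
  "step_pmf G v = embed_pmf (step_prob G v)"

text \<open>A walk of length \<open>j\<close> is the list of its \<open>j + 1\<close> successive positions.\<close>

primrec walk_pmf :: "('a, 'b) pre_digraph \<Rightarrow> nat \<Rightarrow> 'a \<Rightarrow> 'a list pmf" where
  "walk_pmf G 0 v = return_pmf [v]"
| "walk_pmf G (Suc j) v =
     bind_pmf (walk_pmf G j v) (\<lambda>w. map_pmf (\<lambda>u. w @ [u]) (step_pmf G (last w)))"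

definition prob_walk_ends_at :: "('a, 'b) pre_digraph \<Rightarrow> nat \<Rightarrow> 'a \<Rightarrow> 'a \<Rightarrow> real" where
  "prob_walk_ends_at G j v u = measure_pmf.prob (walk_pmf G j v) {w. last w = u}"

text \<open>\<^const>\<open>embed_pmf\<close> is only meaningful on probability mass functions.\<close>

lemma (in digraph) card_out_set: "card {u. dominates G v u} = out_degree G v"
proof -
  have "bij_betw (head G) (out_arcs G v) {u. dominates G v u}"
    unfolding bij_betw_def
  proof
    show "inj_on (head G) (out_arcs G v)"
      by (auto simp: inj_on_def arc_to_ends_def intro!: no_multi_arcs)
    show "head G ` out_arcs G v = {u. dominates G v u}"
      by (auto simp: arcs_ends_conv)
  qed
  then show ?thesis
    by (simp add: bij_betw_same_card out_degree_def)
qed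

lemma (in digraph) out_degree_le_total: "out_degree G v \<le> total_out_degree G"
proof (cases "v \<in> verts G")
  case True
  then show ?thesis
    by (auto simp: total_out_degree_def intro: member_le_sum)
next
  case False
  then have "out_arcs G v = {}"
    by auto
  then show ?thesis
    by (simp add: out_degree_def)
qed

lemma (in digraph) pmf_step_pmf: "pmf (step_pmf G v) u = step_prob G v u"
proof -
  define g where "g = real (total_out_degree G)"
  define N where "N = {u. dominates G v u}"
  have "N \<subseteq> verts G"
    using adj_in_verts(2) by (auto simp: N_def)
  then have N: "finite N" "v \<notin> N"
    using adj_not_same finite_subset[OF _ finite_verts] by (auto simp: N_def)
  have nonneg: "0 \<le> step_prob G v u" for u
    using out_degree_le_total[of v] by (auto simp: step_prob_def divide_le_eq)
  have sum1: "(\<Sum>u\<in>insert v N. step_prob G v u) = 1"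
  proof -
    have "(\<Sum>u\<in>N. step_prob G v u) = (\<Sum>u\<in>N. 1 / g)"
      using N(2) by (intro sum.cong) (auto simp: step_prob_def N_def g_def)
    also have "\<dots> = real (out_degree G v) / g"
      using card_out_set[of v] by (simp add: N_def)
    finally show ?thesis
      using N by (simp add: step_prob_def g_def)
  qed
  have "(\<integral>\<^sup>+u. ennreal (step_prob G v u) \<partial>count_space UNIV)
      = (\<Sum>u\<in>insert v N. ennreal (step_prob G v u))"
    using N by (intro nn_integral_count_space') (auto simp: step_prob_def N_def)
  also have "\<dots> = 1"
    using nonneg by (simp add: sum_ennreal sum1 del: sum.insert)
  finally show ?thesis
    unfolding step_pmf_def by (intro pmf_embed_pmf nonneg)
qed

end

theory Submission
  imports Defs "Jordan_Normal_Form.Schur_Decomposition"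
begin

text \<open>
  The matrix \<open>P = I - L / g\<close> is the transition matrix of the random walk. It is row-stochastic, so
  every eigenvalue \<open>z = 1 - \<lambda>\<close> of \<open>P\<close> lies in the closed unit disc. On this disc
  \<open>z + (1 - z) Ln (1 - z) = (\<Sum>j\<ge>2. z ^ j / (j (j - 1)))\<close>, by partial fractions inside and by an
  Abel argument on the boundary. Sum over the eigenvalues: Schur triangularisation turns power sums of
  the \<open>z\<close> into traces of \<open>P ^ j\<close>, and the diagonal entries of \<open>P ^ j\<close> are the return probabilities.
\<close>

section \<open>Traces of matrix powers via triangular form\<close>

lemma index_mult_mat_sum:
  assumes "A \<in> carrier_mat n m" "B \<in> carrier_mat m p" "i < n" "j < p"
  shows "(A * B) $$ (i, j) = (\<Sum>k<m. A $$ (i, k) * B $$ (k, j))"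
  using assms by (auto simp: scalar_prod_def atLeast0LessThan intro!: sum.cong)

lemma mat_trace_mult_comm:
  fixes A B :: "'a::comm_semiring_0 mat"
  assumes "A \<in> carrier_mat n m" "B \<in> carrier_mat m n"
  shows "mat_trace (A * B) = mat_trace (B * A)"
proof -
  have "mat_trace (A * B) = (\<Sum>i<n. \<Sum>k<m. A $$ (i, k) * B $$ (k, i))"
    using assms by (auto simp: mat_trace_def index_mult_mat_sum[of A n m B n] simp del: index_mult_mat(1))
  also have "\<dots> = (\<Sum>k<m. \<Sum>i<n. B $$ (k, i) * A $$ (i, k))"
    by (subst sum.swap) (simp add: mult.commute)
  also have "\<dots> = mat_trace (B * A)"
    using assms by (auto simp: mat_trace_def index_mult_mat_sum[of B m n A m] simp del: index_mult_mat(1))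
  finally show ?thesis .
qed

lemma mat_trace_similar:
  fixes A B :: "'a::comm_ring_1 mat"
  assumes "similar_mat_wit A B P Q"
  shows "mat_trace A = mat_trace B"
proof -
  define n where "n = dim_row A"
  note w = similar_mat_witD[OF n_def assms]
  have "mat_trace A = mat_trace (P * (B * Q))"
    using w by (simp add: assoc_mult_mat[of P n n B n Q n])
  also have "\<dots> = mat_trace (B * Q * P)"
    using w by (intro mat_trace_mult_comm[of _ n n]) auto
  also have "B * Q * P = B"
    using w by (simp add: assoc_mult_mat[of B n n Q n P n])
  finally show ?thesis .
qed

text \<open>Diagonal and lower part are treated together so that the induction closes. In the
  product sum for \<open>B ^\<^sub>m Suc k\<close>, terms with \<open>l < i\<close> vanish by the
  induction hypothesis, and those with \<open>l > i\<close> vanish because then \<open>l > j\<close>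
  and \<open>B\<close> is triangular; only \<open>l = i\<close> survives.\<close>

lemma upper_triangular_pow:
  fixes B :: "'a::comm_semiring_1 mat"
  assumes B: "B \<in> carrier_mat n n" "upper_triangular B"
  shows "j \<le> i \<Longrightarrow> i < n \<Longrightarrow> (B ^\<^sub>m k) $$ (i, j) = (if i = j then (B $$ (i, i)) ^ k else 0)"
proof (induction k arbitrary: i j)
  case 0
  then show ?case using B by auto
next
  case (Suc k)
  have "(B ^\<^sub>m Suc k) $$ (i, j) = (\<Sum>l<n. (B ^\<^sub>m k) $$ (i, l) * B $$ (l, j))"
    using Suc.prems B by (simp add: index_mult_mat_sum[of _ n n _ n] del: index_mult_mat(1))
  also have "\<dots> = (\<Sum>l<n. if l = i then (B $$ (i, i)) ^ k * B $$ (i, j) else 0)"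
  proof (intro sum.cong refl)
    fix l assume l: "l \<in> {..<n}"
    show "(B ^\<^sub>m k) $$ (i, l) * B $$ (l, j) = (if l = i then (B $$ (i, i)) ^ k * B $$ (i, j) else 0)"
    proof (cases "l \<le> i")
      case True
      then show ?thesis using Suc.IH[of l i] Suc.prems by auto
    next
      case False
      then have "B $$ (l, j) = 0"
        using upper_triangularD[OF B(2), of j l] B(1) Suc.prems l by auto
      then show ?thesis using False by simp
    qed
  qed
  also have "\<dots> = (if i = j then (B $$ (i, i)) ^ Suc k else 0)"
    using upper_triangularD[OF B(2), of j i] Suc.prems B(1) by (auto simp: mult.commute)
  finally show ?case .
qed

text \<open>Schur decomposition conjugates \<open>A\<close> to a triangular \<open>B\<close> with
  diagonal \<open>es\<close>. Since \<open>P\<close> and \<open>Q\<close> are mutually inverse, the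
  same pair conjugates I - A to I - B, which is again triangular. Similarity passes to powers and
  preserves the trace, and the diagonal of a triangular power consists of powers.\<close>

lemma trace_one_minus_pow:
  fixes A :: "'a::conjugatable_ordered_field mat"
  assumes A: "A \<in> carrier_mat n n" and es: "char_poly A = (\<Prod>e\<leftarrow>es. [:- e, 1:])"
  shows "mat_trace ((1\<^sub>m n - A) ^\<^sub>m k) = (\<Sum>i<length es. (1 - es ! i) ^ k)"
proof -
  obtain B P Q where "schur_decomposition A es = (B, P, Q)"
    by (cases "schur_decomposition A es")
  from schur_decomposition[OF A es this]
  have sim: "similar_mat_wit A B P Q" and ut: "upper_triangular B" and diag: "diag_mat B = es"
    by auto
  note w = similar_mat_witD2[OF A sim]
  have "P * (1\<^sub>m n - B) * Q = 1\<^sub>m n - A"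
    using w(1,4-7) unfolding w(3)
    by (subst mult_minus_distrib_mat[of P n n _ n], simp_all)
       (subst minus_mult_distrib_mat[of _ n n _ Q n], simp_all)
  then have sim': "similar_mat_wit (1\<^sub>m n - A) (1\<^sub>m n - B) P Q"
    using w by (intro similar_mat_witI[of _ _ n]) auto
  have ut': "upper_triangular (1\<^sub>m n - B)"
    using ut w by (auto intro!: upper_triangularI dest: upper_triangularD)
  have len: "length es = n" and nth: "\<And>i. i < n \<Longrightarrow> es ! i = B $$ (i, i)"
    using diag w by (auto simp: diag_mat_def)
  have "mat_trace ((1\<^sub>m n - A) ^\<^sub>m k) = mat_trace ((1\<^sub>m n - B) ^\<^sub>m k)"
    by (rule mat_trace_similar[OF similar_mat_wit_pow[OF sim']])
  also have "\<dots> = (\<Sum>i<n. (1 - B $$ (i, i)) ^ k)"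
    using upper_triangular_pow[OF minus_carrier_mat[OF w(5)] ut', where k = k] w(5)
    by (auto simp: mat_trace_def)
  finally show ?thesis
    by (simp add: len nth)
qed

section \<open>Eigenvalue lists and the row sum bound\<close>

lemma char_poly_eq_prod_eigenvalues:
  assumes A: "A \<in> carrier_mat n n" and es: "lists_eigenvalues A es"
  shows "char_poly (map_mat complex_of_real A) = (\<Prod>e\<leftarrow>es. [:- e, 1:])"
proof -
  define p where "p = char_poly (map_mat complex_of_real A)"
  \<comment> \<open>Being monic removes the constant factor from the decomposition into linear
    factors, which leaves the form that Schur decomposition expects.\<close>
  have "lead_coeff p = 1"
    using degree_monic_char_poly[of "map_mat complex_of_real A" n] A by (simp add: p_def)
  then have "p = (\<Prod>x\<in>#proots p. [:- x, 1:])"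
    using complex_poly_decompose_multiset[of p] by simp
  also have "proots p = mset es"
    using es by (simp add: lists_eigenvalues_def p_def)
  also have "(\<Prod>x\<in>#mset es. [:- x, 1:]) = (\<Prod>e\<leftarrow>es. [:- e, 1:])"
    by (simp flip: prod_mset_prod_list)
  finally show ?thesis
    by (simp add: p_def)
qed

text \<open>Maximum argument: read the eigenvector equation in the coordinate where the eigenvector
  has largest modulus, bound every other coordinate by that one, and cancel it.\<close>

lemma eigenvalue_norm_le_row_sum:
  fixes A :: "'a::{real_normed_field} mat"
  assumes A: "A \<in> carrier_mat n n"
    and rows: "\<And>i. i < n \<Longrightarrow> (\<Sum>j<n. norm (A $$ (i, j))) \<le> c"
    and ev: "eigenvalue A z"
  shows "norm z \<le> c"
proof -
  from ev obtain v where v: "v \<in> carrier_vec n" "v \<noteq> 0\<^sub>v n" "A *\<^sub>v v = z \<cdot>\<^sub>v v"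
    using A by (auto simp: eigenvalue_def eigenvector_def)
  then obtain l where l: "l < n" "vec_index v l \<noteq> 0"
    by (metis carrier_vecD eq_vecI index_zero_vec)
  let ?N = "\<lambda>i. norm (vec_index v i)"
  obtain i where i: "i < n" and max: "\<And>j. j < n \<Longrightarrow> ?N j \<le> ?N i"
  proof -
    have fin: "finite (?N ` {..<n})" and ne: "?N ` {..<n} \<noteq> {}"
      using l by auto
    from Max_in[OF this] obtain i where "i < n" "Max (?N ` {..<n}) = ?N i"
      by auto
    with fin that show thesis
      by (metis Max_ge imageI lessThan_iff)
  qed
  \<comment> \<open>The eigenvector has a nonzero entry \<open>l\<close>, so the maximal modulus can
    be cancelled at the end.\<close>
  have pos: "?N i > 0"
    using max[OF l(1)] l(2) by (meson less_le_trans zero_less_norm_iff)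
  have "z * vec_index v i = vec_index (A *\<^sub>v v) i"
    using v i by simp
  also have "\<dots> = (\<Sum>j<n. A $$ (i, j) * vec_index v j)"
    using i v(1) A by (auto simp: scalar_prod_def atLeast0LessThan intro!: sum.cong)
  finally have "z * vec_index v i = (\<Sum>j<n. A $$ (i, j) * vec_index v j)" .
  then have "norm z * ?N i = norm (\<Sum>j<n. A $$ (i, j) * vec_index v j)"
    by (metis norm_mult)
  also have "\<dots> \<le> (\<Sum>j<n. norm (A $$ (i, j)) * ?N i)"
    by (rule sum_norm_le) (auto simp: norm_mult intro!: mult_left_mono max)
  also have "\<dots> \<le> c * ?N i"
    using rows[OF i] by (simp flip: sum_distrib_right add: mult_right_mono)
  finally show ?thesis
    using pos by simp
qed

section \<open>The power series with coefficients 1/(j(j-1)) on the closed disc\<close>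

lemma sums_inverse_pronic: "(\<lambda>j. 1 / (real (j + 2) * (real (j + 2) - 1))) sums 1"
proof -
  \<comment> \<open>The shifted coefficient 1/((j+2)(j+1)) is the difference 1/(j+1) - 1/(j+2), so
    the series telescopes.\<close>
  have "(\<lambda>j. inverse (real (Suc j)) - inverse (real (Suc (Suc j)))) sums (inverse (real (Suc 0)) - 0)"
    by (rule telescope_sums'[OF LIMSEQ_inverse_real_of_nat])
  moreover have "inverse (real (Suc j)) - inverse (real (Suc (Suc j))) = 1 / (real (j + 2) * (real (j + 2) - 1))" for j
    by (simp add: field_simps)
  ultimately show ?thesis
    by simp
qed

lemma pronic_power_series_open_disc:
  fixes z :: complex
  assumes z: "cmod z < 1"
  shows "(\<lambda>j. z ^ (j + 2) / of_real (real (j + 2) * (real (j + 2) - 1))) sums (z + (1 - z) * Ln (1 - z))"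
proof -
  have "(\<lambda>n. z ^ n / of_nat n) sums (- Ln (1 - z))"
    using sums_minus[OF Ln_series'[of "- z"]] z by simp
  \<comment> \<open>The dropped term at index 0 is a division by zero, hence 0. The next shift drops
    the term \<open>z\<close>.\<close>
  then have 1: "(\<lambda>n. z ^ Suc n / of_nat (Suc n)) sums (- Ln (1 - z))"
    by (subst sums_Suc_iff) simp
  then have 2: "(\<lambda>n. z ^ Suc (Suc n) / of_nat (Suc (Suc n))) sums (- Ln (1 - z) - z)"
    by (subst sums_Suc_iff) simp
  \<comment> \<open>Partial fractions: 1/(n+1) comes from \<open>z\<close> times the logarithmic
    series, and 1/(n+2) from that series without its first term.\<close>
  have "(\<lambda>n. z * (z ^ Suc n / of_nat (Suc n)) - z ^ Suc (Suc n) / of_nat (Suc (Suc n)))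
      sums (z * (- Ln (1 - z)) - (- Ln (1 - z) - z))"
    by (intro sums_diff sums_mult 1 2)
  moreover have "z * (z ^ Suc n / of_nat (Suc n)) - z ^ Suc (Suc n) / of_nat (Suc (Suc n))
      = z ^ (n + 2) / of_real (real (n + 2) * (real (n + 2) - 1))" for n
  proof -
    have "of_nat n + 1 \<noteq> (0::complex)" "of_nat n + 2 \<noteq> (0::complex)"
      by (metis of_nat_Suc of_nat_neq_0 add.commute,
          metis of_nat_Suc of_nat_neq_0 add.commute add_2_eq_Suc' of_nat_add of_nat_numeral)
    then show ?thesis
      by (simp add: divide_simps) (simp add: algebra_simps)
  qed
  ultimately show ?thesis
    by (simp add: algebra_simps)
qed

text \<open>The coefficients are absolutely summable, so the series is continuous up to the unit
  circle. The closed form is continuous there too, except that \<open>Ln\<close> is singular at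
  \<open>z = 1\<close>; that point is treated apart.\<close>

lemma pronic_power_series:
  fixes z :: complex
  assumes z: "cmod z \<le> 1"
  shows "(\<lambda>j. z ^ (j + 2) / of_real (real (j + 2) * (real (j + 2) - 1))) sums (z + (1 - z) * Ln (1 - z))"
proof (cases "z = 1")
  case True
  \<comment> \<open>The factor \<open>1 - z\<close> is 0 here, so the value assigned to
    \<open>Ln 0\<close> does not matter and both sides are 1.\<close>
  then show ?thesis
    using sums_of_real[OF sums_inverse_pronic, where 'a = complex] by simp
next
  case False
  define c where "c j = 1 / (real (j + 2) * (real (j + 2) - 1))" for j
  define f where "f j w = w ^ (j + 2) / complex_of_real (real (j + 2) * (real (j + 2) - 1))" for j w
  define F where "F w = (\<Sum>j. f j w)" for w
  define g where "g w = w + (1 - w) * Ln (1 - w)" for w :: complex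
  have c: "summable c"
    unfolding c_def by (rule sums_summable[OF sums_inverse_pronic])
  have bound: "norm (f j w) \<le> c j" if "w \<in> cball 0 1" for j w
  proof -
    have "norm w ^ (j + 2) \<le> 1"
      using that by (intro power_le_one) auto
    moreover have "norm (f j w) = norm w ^ (j + 2) * c j"
      unfolding f_def c_def norm_divide norm_power norm_of_real by simp
    moreover have "c j \<ge> 0"
      by (simp add: c_def)
    ultimately show ?thesis
      by (simp add: mult_left_le_one_le)
  qed
  \<comment> \<open>The majorant \<open>c\<close> is independent of \<open>w\<close>, so convergence
    is uniform and continuity of the partial sums passes to \<open>F\<close>.\<close>
  have "uniform_limit (cball 0 1) (\<lambda>n w. \<Sum>j<n. f j w) F sequentially"
    unfolding F_def by (rule Weierstrass_m_test[OF _ c]) (use bound in auto)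
  moreover have "continuous_on (cball 0 1) (\<lambda>w. \<Sum>j<n. f j w)" for n
    unfolding f_def by (intro continuous_intros) (auto simp flip: of_nat_Suc of_nat_add)
  ultimately have F: "continuous_on (cball 0 1) F"
    by (intro uniform_limit_theorem[where F = sequentially]) auto
  \<comment> \<open>Abel's argument: approach \<open>z\<close> radially.\<close>
  define w where "w m = of_real (1 - inverse (real (Suc m))) * z" for m
  have r: "0 \<le> 1 - inverse (real (Suc m))" "1 - inverse (real (Suc m)) < 1" for m
    by (auto simp: field_simps)
  have w1: "cmod (w m) < 1" for m
  proof -
    have "cmod (w m) = (1 - inverse (real (Suc m))) * cmod z"
      unfolding w_def norm_mult norm_of_real using r[of m] by simp
    also have "\<dots> \<le> (1 - inverse (real (Suc m))) * 1"
      by (rule mult_left_mono[OF z r(1)])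
    also have "\<dots> < 1"
      using r(2)[of m] by simp
    finally show ?thesis .
  qed
  have "(\<lambda>m. of_real (1 - inverse (real (Suc m))) * z) \<longlonglongrightarrow> of_real (1 - 0) * z"
    by (intro tendsto_intros LIMSEQ_inverse_real_of_nat)
  then have wz: "w \<longlonglongrightarrow> z"
    by (simp add: w_def[abs_def])
  have Fw: "(\<lambda>m. F (w m)) \<longlonglongrightarrow> F z"
    by (rule continuous_on_tendsto_compose[OF F wz]) (use z w1 in \<open>auto intro!: always_eventually less_imp_le\<close>)
  \<comment> \<open>The branch cut is met only for real \<open>z \<ge> 1\<close>, which within the
    closed disc means \<open>z = 1\<close>.\<close>
  have "1 - z \<notin> \<real>\<^sub>\<le>\<^sub>0"
  proof
    assume "1 - z \<in> \<real>\<^sub>\<le>\<^sub>0"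
    then have "Re z \<ge> 1" "Im z = 0"
      by (auto simp: complex_nonpos_Reals_iff)
    with z False show False
      using complex_Re_le_cmod[of z] by (auto simp: complex_eq_iff)
  qed
  then have "isCont g z"
    unfolding g_def by (intro continuous_intros) auto
  then have "(\<lambda>m. g (w m)) \<longlonglongrightarrow> g z"
    using wz by (rule isCont_tendsto_compose)
  moreover have "F (w m) = g (w m)" for m
    using pronic_power_series_open_disc[OF w1[of m]] by (simp add: F_def f_def g_def sums_iff)
  ultimately have "F z = g z"
    using LIMSEQ_unique[OF Fw] by simp
  moreover have "summable (\<lambda>j. f j z)"
    by (rule summable_comparison_test'[OF c, of 0]) (use z in \<open>auto intro!: bound\<close>)
  ultimately show ?thesis
    by (simp add: sums_iff F_def f_def g_def)
qed

section \<open>The distribution of the end point of the walk\<close>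

lemma walk_pmf_Suc_last:
  "map_pmf last (walk_pmf G (Suc j) v) = bind_pmf (map_pmf last (walk_pmf G j v)) (step_pmf G)"
  by (simp add: map_bind_pmf bind_map_pmf pmf.map_comp o_def)

lemma prob_walk_ends_at_eq_pmf: "prob_walk_ends_at G j v u = pmf (map_pmf last (walk_pmf G j v)) u"
  by (simp add: prob_walk_ends_at_def pmf_map vimage_def)

context digraph
begin

lemma set_step_pmf_subset:
  assumes "v \<in> verts G"
  shows "set_pmf (step_pmf G v) \<subseteq> verts G"
proof
  fix u assume "u \<in> set_pmf (step_pmf G v)"
  then have "step_prob G v u \<noteq> 0"
    by (simp add: set_pmf_iff pmf_step_pmf)
  then show "u \<in> verts G"
    using assms adj_in_verts(2) by (auto simp: step_prob_def split: if_splits)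
qed

lemma walk_last_in_verts:
  assumes "v \<in> verts G"
  shows "set_pmf (map_pmf last (walk_pmf G j v)) \<subseteq> verts G"
proof (induction j)
  case 0
  then show ?case using assms by simp
next
  case (Suc j)
  then show ?case
    unfolding walk_pmf_Suc_last set_bind_pmf using set_step_pmf_subset by blast
qed

text \<open>Chapman-Kolmogorov recursion, by conditioning on the position before the last step. The
  walk never leaves the finite vertex set, so the integral is a finite sum.\<close>

lemma prob_walk_ends_at_Suc:
  assumes "v \<in> verts G"
  shows "prob_walk_ends_at G (Suc j) v u = (\<Sum>w\<in>verts G. step_prob G w u * prob_walk_ends_at G j v w)"
  unfolding prob_walk_ends_at_eq_pmf walk_pmf_Suc_last pmf_bind
  using walk_last_in_verts[OF assms]
  by (subst integral_measure_pmf_real[of "verts G"]) (auto simp: pmf_step_pmf)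

end

section \<open>Transposes, complexification and shifted eigenvalues\<close>

lemma pow_mat_Suc_left:
  fixes A :: "'a::semiring_1 mat"
  assumes A: "A \<in> carrier_mat n n"
  shows "A ^\<^sub>m Suc k = A * A ^\<^sub>m k"
proof (induction k)
  case 0
  then show ?case using A by simp
next
  case (Suc k)
  have "A ^\<^sub>m Suc (Suc k) = A * A ^\<^sub>m k * A"
    using Suc.IH by simp
  also have "\<dots> = A * A ^\<^sub>m Suc k"
    using A by (simp add: assoc_mult_mat[of A n n _ n _ n])
  finally show ?case .
qed

text \<open>Transposition reverses products, so the recursion that appends a factor on the right
  turns into the one that puts it on the left.\<close>

lemma transpose_pow_mat:
  fixes A :: "'a::comm_semiring_1 mat"
  assumes A: "A \<in> carrier_mat n n"
  shows "transpose_mat A ^\<^sub>m k = transpose_mat (A ^\<^sub>m k)"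
proof (induction k)
  case 0
  then show ?case using A by simp
next
  case (Suc k)
  have "transpose_mat A ^\<^sub>m Suc k = transpose_mat (A * A ^\<^sub>m k)"
    using A Suc.IH by (simp add: transpose_mult[of A n n _ n])
  then show ?case
    by (simp only: pow_mat_Suc_left[OF A])
qed

lemma mat_trace_transpose:
  assumes "A \<in> carrier_mat n n"
  shows "mat_trace (transpose_mat A) = mat_trace A"
  using assms by (auto simp: mat_trace_def)

lemma mat_trace_map_of_real:
  assumes "A \<in> carrier_mat n n"
  shows "mat_trace (map_mat complex_of_real A) = complex_of_real (mat_trace A)"
  using assms by (auto simp: mat_trace_def)

lemma eigenvalue_one_minus:
  fixes A :: "'a::comm_ring_1 mat"
  assumes A: "A \<in> carrier_mat n n" and "eigenvalue A e"
  shows "eigenvalue (1\<^sub>m n - A) (1 - e)"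
proof -
  obtain v where v: "v \<in> carrier_vec n" "v \<noteq> 0\<^sub>v n" "A *\<^sub>v v = e \<cdot>\<^sub>v v"
    using assms by (auto simp: eigenvalue_def eigenvector_def)
  have "(1\<^sub>m n - A) *\<^sub>v v = (1 - e) \<cdot>\<^sub>v v"
    using v A by (subst minus_mult_distrib_mat_vec[of _ n n]) (auto simp: algebra_simps)
  then show ?thesis
    using v A by (auto simp: eigenvalue_def eigenvector_def)
qed

lemma eigenvalue_of_lists_eigenvalues:
  assumes A: "A \<in> carrier_mat n n" and "lists_eigenvalues A es" "e \<in> set es"
  shows "eigenvalue (map_mat complex_of_real A) e"
proof -
  let ?p = "char_poly (map_mat complex_of_real A)"
  have "?p \<noteq> 0"
    using degree_monic_char_poly[of "map_mat complex_of_real A" n] A by auto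
  moreover have "e \<in># proots ?p"
    using assms by (metis lists_eigenvalues_def set_mset_mset)
  ultimately have "poly ?p e = 0"
    by simp
  then show ?thesis
    using A by (simp add: eigenvalue_root_char_poly[of _ n])
qed

lemma sum_nth_eq_sum:
  assumes "distinct vs" "set vs = V"
  shows "(\<Sum>i<length vs. f (vs ! i)) = sum f V"
  using sum.reindex_bij_betw[OF bij_betw_nth[OF assms(1) refl refl], of f] assms by simp

section \<open>The transition matrix: return probabilities and spectrum\<close>

lemma normalized_laplacian_carrier:
  "normalized_laplacian G vs \<in> carrier_mat (length vs) (length vs)"
  by (simp add: normalized_laplacian_def laplacian_def)

lemma mat_trace_laplacian:
  assumes "distinct vs" "set vs = verts G"
  shows "mat_trace (laplacian G vs) = real (total_out_degree G)"
  using sum_nth_eq_sum[OF assms, of "\<lambda>v. real (out_degree G v)"]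
  by (simp add: mat_trace_def laplacian_def total_out_degree_def)

text \<open>The trace of the Laplacian is g, so dividing by it makes each arc entry the probability
  1/g of a move and leaves on the diagonal the probability of staying. Distinctness of
  \<open>vs\<close> matches equal indices with equal vertices.\<close>

lemma one_minus_normalized_laplacian_index:
  assumes "distinct vs" "set vs = verts G" "i < length vs" "j < length vs"
  shows "(1\<^sub>m (length vs) - normalized_laplacian G vs) $$ (i, j) = step_prob G (vs ! i) (vs ! j)"
  using assms mat_trace_laplacian[OF assms(1,2)]
  by (auto simp: normalized_laplacian_def laplacian_def step_prob_def nth_eq_iff_index_eq)

text \<open>The out-degrees divided by g add up to 1. Positivity of g matters: with division by zero
  they would add up to 0.\<close>

lemma mat_trace_one_minus_normalized_laplacian:
  assumes "distinct vs" "set vs = verts G" "total_out_degree G > 0"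
  shows "mat_trace (1\<^sub>m (length vs) - normalized_laplacian G vs) = real (length vs) - 1"
proof -
  have "mat_trace (1\<^sub>m (length vs) - normalized_laplacian G vs)
      = (\<Sum>i<length vs. 1 - real (out_degree G (vs ! i)) / real (total_out_degree G))"
    using assms carrier_matD[OF normalized_laplacian_carrier[of G vs]]
    by (auto simp: mat_trace_def one_minus_normalized_laplacian_index step_prob_def
        simp del: index_minus_mat(1) intro!: sum.cong)
  also have "\<dots> = real (length vs) - real (\<Sum>i<length vs. out_degree G (vs ! i)) / real (total_out_degree G)"
    by (simp add: sum_subtractf sum_divide_distrib)
  also have "(\<Sum>i<length vs. out_degree G (vs ! i)) = total_out_degree G"
    using sum_nth_eq_sum[OF assms(1,2)] by (simp add: total_out_degree_def)
  finally show ?thesis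
    using assms(3) by simp
qed

context digraph
begin

lemma total_out_degree_pos:
  assumes "arcs G \<noteq> {}"
  shows "total_out_degree G > 0"
proof -
  obtain a where "a \<in> arcs G"
    using assms by blast
  then have "a \<in> out_arcs G (tail G a)"
    by simp
  then have "out_degree G (tail G a) > 0"
    unfolding out_degree_def by (metis card_gt_0_iff empty_iff finite_out_arcs)
  then show ?thesis
    using out_degree_le_total[of "tail G a"] by linarith
qed

lemma sum_step_prob:
  assumes "v \<in> verts G"
  shows "(\<Sum>u\<in>verts G. step_prob G v u) = 1"
  using sum_pmf_eq_1[OF finite_verts set_step_pmf_subset[OF assms]] by (simp add: pmf_step_pmf)

text \<open>Because of the transpose, the column index is the start of the walk and the row index
  its end.\<close>

lemma pow_transition_matrix_index:
  assumes vs: "distinct vs" "set vs = verts G" and "i < length vs" "k < length vs"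
  shows "(transpose_mat (1\<^sub>m (length vs) - normalized_laplacian G vs) ^\<^sub>m j) $$ (i, k)
    = prob_walk_ends_at G j (vs ! k) (vs ! i)"
  using assms(3)
\<comment> \<open>The start \<open>k\<close> stays fixed; only the end point varies in the
  recursion.\<close>
proof (induction j arbitrary: i)
  case 0
  then show ?case
    using assms carrier_matD[OF normalized_laplacian_carrier[of G vs]]
    by (auto simp: prob_walk_ends_at_eq_pmf nth_eq_iff_index_eq)
next
  case (Suc j)
  let ?n = "length vs"
  let ?M = "transpose_mat (1\<^sub>m ?n - normalized_laplacian G vs)"
  have M: "?M \<in> carrier_mat ?n ?n"
    using normalized_laplacian_carrier[of G vs] by auto
  \<comment> \<open>The factor split off on the left is the last step of the walk, from
    \<open>vs ! l\<close> to \<open>vs ! i\<close>.\<close>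
  have "(?M ^\<^sub>m Suc j) $$ (i, k) = (\<Sum>l<?n. ?M $$ (i, l) * (?M ^\<^sub>m j) $$ (l, k))"
    unfolding pow_mat_Suc_left[OF M] using M Suc.prems assms(4)
    by (intro index_mult_mat_sum) auto
  also have "\<dots> = (\<Sum>l<?n. step_prob G (vs ! l) (vs ! i) * prob_walk_ends_at G j (vs ! k) (vs ! l))"
  proof (intro sum.cong refl)
    fix l assume l: "l \<in> {..<?n}"
    then have "?M $$ (i, l) = (1\<^sub>m ?n - normalized_laplacian G vs) $$ (l, i)"
      using carrier_matD[OF normalized_laplacian_carrier[of G vs]] Suc.prems by simp
    then show "?M $$ (i, l) * (?M ^\<^sub>m j) $$ (l, k)
        = step_prob G (vs ! l) (vs ! i) * prob_walk_ends_at G j (vs ! k) (vs ! l)"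
      using l Suc.IH[of l] one_minus_normalized_laplacian_index[OF vs, of l i] Suc.prems
      by (simp only: lessThan_iff)
  qed
  also have "\<dots> = (\<Sum>w\<in>verts G. step_prob G w (vs ! i) * prob_walk_ends_at G j (vs ! k) w)"
    by (rule sum_nth_eq_sum[OF vs])
  also have "\<dots> = prob_walk_ends_at G (Suc j) (vs ! k) (vs ! i)"
    using assms(4) vs(2) prob_walk_ends_at_Suc[of "vs ! k" j "vs ! i"] nth_mem by metis
  finally show ?case .
qed

text \<open>The rows of the transition matrix are probability distributions: entries equal their
  moduli and each row sums to 1, so the row sum bound applies with constant 1.\<close>

lemma norm_one_minus_eigenvalue_le_1:
  assumes vs: "distinct vs" "set vs = verts G"
    and es: "lists_eigenvalues (normalized_laplacian G vs) es" "e \<in> set es"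
  shows "cmod (1 - e) \<le> 1"
proof (rule eigenvalue_norm_le_row_sum)
  let ?n = "length vs"
  let ?L = "normalized_laplacian G vs"
  let ?A = "1\<^sub>m ?n - map_mat complex_of_real ?L"
  note L = normalized_laplacian_carrier[of G vs]
  show "?A \<in> carrier_mat ?n ?n"
    using L by auto
  show "eigenvalue ?A (1 - e)"
    using L by (intro eigenvalue_one_minus eigenvalue_of_lists_eigenvalues[OF L es]) auto
  fix i assume i: "i < ?n"
  have "norm (?A $$ (i, j)) = step_prob G (vs ! i) (vs ! j)" if "j < ?n" for j
  proof -
    have "?A $$ (i, j) = complex_of_real ((1\<^sub>m ?n - ?L) $$ (i, j))"
      using carrier_matD[OF L] i that by simp
    then show ?thesis
      using pmf_nonneg[of "step_pmf G (vs ! i)" "vs ! j"]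
      unfolding one_minus_normalized_laplacian_index[OF vs i that] by (simp add: pmf_step_pmf)
  qed
  then have "(\<Sum>j<?n. norm (?A $$ (i, j))) = (\<Sum>j<?n. step_prob G (vs ! i) (vs ! j))"
    by (intro sum.cong) auto
  also have "\<dots> = 1"
    using sum_step_prob[of "vs ! i"] nth_mem[OF i] vs(2)
    by (simp add: sum_nth_eq_sum[OF vs, of "step_prob G (vs ! i)"])
  finally show "(\<Sum>j<?n. norm (?A $$ (i, j))) \<le> 1"
    by simp
qed

end

text \<open>Transposition does not change the trace of a power, and the embedding of the reals
  commutes with matrix powers, so the question moves to the complex matrix, where the characteristic
  polynomial splits.\<close>

lemma mat_trace_pow_eq_sum_eigenvalues:
  fixes L :: "real mat"
  assumes L: "L \<in> carrier_mat n n" and es: "lists_eigenvalues L es"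
  shows "complex_of_real (mat_trace (transpose_mat (1\<^sub>m n - L) ^\<^sub>m j)) = (\<Sum>k<length es. (1 - es ! k) ^ j)"
proof -
  have P: "1\<^sub>m n - L \<in> carrier_mat n n"
    using L by (rule minus_carrier_mat)
  have "complex_of_real (mat_trace (transpose_mat (1\<^sub>m n - L) ^\<^sub>m j))
      = mat_trace (map_mat complex_of_real ((1\<^sub>m n - L) ^\<^sub>m j))"
    using P by (simp add: transpose_pow_mat mat_trace_transpose[of _ n] mat_trace_map_of_real[of _ n])
  also have "map_mat complex_of_real ((1\<^sub>m n - L) ^\<^sub>m j) = map_mat complex_of_real (1\<^sub>m n - L) ^\<^sub>m j"
    by (rule of_real_hom.mat_hom_pow[OF P])
  also have "map_mat complex_of_real (1\<^sub>m n - L) = 1\<^sub>m n - map_mat complex_of_real L"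
    using L by (intro eq_matI) auto
  also have "mat_trace (\<dots> ^\<^sub>m j) = (\<Sum>k<length es. (1 - es ! k) ^ j)"
    using L by (intro trace_one_minus_pow char_poly_eq_prod_eigenvalues[OF L es]) auto
  finally show ?thesis .
qed

section \<open>Entropy of the normalized Laplacian\<close>

theorem mainTheorem6:
  fixes G :: "('a, 'b) pre_digraph"
    and vs :: "'a list"
    and n :: nat
    and es :: "complex list"
    and M :: "real mat"
  assumes "digraph G"
    and "arcs G \<noteq> {}"
    and "distinct vs" and "set vs = verts G" and "length vs = n"
    and "lists_eigenvalues (normalized_laplacian G vs) es"
    and "M = transpose_mat (1\<^sub>m n - normalized_laplacian G vs)"
  shows "summable (\<lambda>j. mat_trace (M ^\<^sub>m (j + 2)) / (real (j + 2) * (real (j + 2) - 1))) \<and>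
    (\<forall>k<n. summable (\<lambda>j. prob_walk_ends_at G (j + 2) (vs ! k) (vs ! k) / (real (j + 2) * (real (j + 2) - 1)))) \<and>
    von_neumann_entropy es = complex_of_real
      (1 / ln 2 * (mat_trace M - (\<Sum>j. mat_trace (M ^\<^sub>m (j + 2)) / (real (j + 2) * (real (j + 2) - 1))))) \<and>
    von_neumann_entropy es = complex_of_real
      (1 / ln 2 * (real n - 1 - (\<Sum>k<n. \<Sum>j.
         prob_walk_ends_at G (j + 2) (vs ! k) (vs ! k) / (real (j + 2) * (real (j + 2) - 1)))))"
proof -
  interpret digraph G by fact
  define q where "q j = real (j + 2) * (real (j + 2) - 1)" for j :: nat
  define p where "p k j = prob_walk_ends_at G (j + 2) (vs ! k) (vs ! k)" for k j
  note vs = assms(3,4) and n = assms(5) and es = assms(6) and M_eq = assms(7)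
  have L: "normalized_laplacian G vs \<in> carrier_mat n n"
    using normalized_laplacian_carrier[of G vs] n by simp
  have M: "M \<in> carrier_mat n n"
    using minus_carrier_mat[OF L] by (simp add: M_eq)
  have q: "q j > 0" for j
    by (simp add: q_def)
  have p_summable: "summable (\<lambda>j. p k j / q j)" for k
  proof (rule summable_comparison_test'[of "\<lambda>j. 1 / q j" 0])
    show "summable (\<lambda>j. 1 / q j)"
      unfolding q_def by (rule sums_summable[OF sums_inverse_pronic])
    show "norm (p k j / q j) \<le> 1 / q j" for j
      using q[of j] by (simp add: p_def prob_walk_ends_at_def divide_right_mono)
  qed
  have tr_M_pow: "mat_trace (M ^\<^sub>m (j + 2)) = (\<Sum>k<n. p k j)" for j
  proof -
    have "(M ^\<^sub>m (j + 2)) $$ (k, k) = p k j" if "k < n" for k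
      using pow_transition_matrix_index[OF vs, of k k "j + 2"] that n
      unfolding M_eq p_def by blast
    then show ?thesis
      using pow_mat_dim_square(1)[OF M, of "j + 2"] unfolding mat_trace_def by simp
  qed
  have tr_M: "mat_trace M = real n - 1"
    using mat_trace_one_minus_normalized_laplacian[OF vs total_out_degree_pos[OF assms(2)]] n
    by (simp add: M_eq mat_trace_transpose[OF minus_carrier_mat[OF L]])
  define T where "T = (\<Sum>k<n. \<Sum>j. p k j / q j)"
  \<comment> \<open>The sum over the vertices is finite, so it may be exchanged with the convergent
    series. This identifies the trace series with the double sum over return probabilities.\<close>
  have T: "(\<lambda>j. mat_trace (M ^\<^sub>m (j + 2)) / q j) sums T"
    unfolding tr_M_pow sum_divide_distrib T_def by (intro sums_sum summable_sums p_summable)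
  have tr_eigen: "complex_of_real (mat_trace (M ^\<^sub>m j)) = (\<Sum>k<length es. (1 - es ! k) ^ j)" for j
    unfolding M_eq by (rule mat_trace_pow_eq_sum_eigenvalues[OF L es])
  \<comment> \<open>The power series is taken at \<open>z = 1 - es ! k\<close>; the unsimplified
    \<open>1 - (1 - es ! k)\<close> keeps the shape of its closed form.\<close>
  have "(\<lambda>j. \<Sum>k<length es. (1 - es ! k) ^ (j + 2) / of_real (q j)) sums
      (\<Sum>k<length es. (1 - es ! k) + (1 - (1 - es ! k)) * Ln (1 - (1 - es ! k)))"
    unfolding q_def
    by (intro sums_sum pronic_power_series norm_one_minus_eigenvalue_le_1[OF vs es]) auto
  also have "(\<lambda>j. \<Sum>k<length es. (1 - es ! k) ^ (j + 2) / of_real (q j))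
      = (\<lambda>j. complex_of_real (mat_trace (M ^\<^sub>m (j + 2)) / q j))"
    by (simp only: of_real_divide tr_eigen sum_divide_distrib)
  \<comment> \<open>The same series has been summed over eigenvalues and over vertices; uniqueness
    of limits equates the results.\<close>
  finally have "(\<Sum>k<length es. (1 - es ! k) + (1 - (1 - es ! k)) * Ln (1 - (1 - es ! k)))
      = complex_of_real T"
    by (rule sums_unique2) (rule sums_of_real[OF T])
  then have "(\<Sum>k<length es. 1 - es ! k) + (\<Sum>k<length es. es ! k * Ln (es ! k)) = complex_of_real T"
    by (simp add: sum.distrib)
  moreover have "complex_of_real (mat_trace M) = (\<Sum>k<length es. 1 - es ! k)"
    using tr_eigen[of 1] M by simp
  \<comment> \<open>For a zero eigenvalue both sides contribute 0: \<open>entropy_fun\<close> by its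
    first case, the product by its factor 0.\<close>
  moreover have "von_neumann_entropy es * complex_of_real (ln 2) = - (\<Sum>k<length es. es ! k * Ln (es ! k))"
    unfolding von_neumann_entropy_def sum_distrib_right sum_negf[symmetric]
    by (intro sum.cong) (auto simp: entropy_fun_def)
  ultimately have "von_neumann_entropy es * complex_of_real (ln 2) = complex_of_real (mat_trace M - T)"
    unfolding of_real_diff by (metis add_diff_cancel_left' minus_diff_eq)
  then have "von_neumann_entropy es = complex_of_real (1 / ln 2 * (mat_trace M - T))"
    by (simp add: field_simps)
  then show ?thesis
    using T p_summable tr_M unfolding T_def p_def q_def by (auto simp only: sums_iff)
qed

end
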